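(* Let $T\in\mathcal{BC}(X)$. For all $q,s\in\rho_S(T)$ with $s\notin[q]$ the following equation holds: $$S^{-1}_R(s,T)\mathcal P^L_2(q,T)+\mathcal P^R_2(s,T)S^{-1}_L(q,T)-4\mathcal Q_{c,s}(T)^{-1}\,\underline T\,\mathcal Q_{c,q}(T)^{-1}$$ $$=\big[(\mathcal P^R_2(s,T)-\mathcal P_2^L(q,T))q-\bar s(\mathcal P_2^R(s,T)-\mathcal P_2^L(q,T))\big]\mathcal Q_s(q)^{-1},$$ where $\mathcal Q_s(q):=q^2-2s_0q+|s|^2$ and $\underline T=T_1e_1+T_2e_2+T_3e_3$.
   Context: $\mathbb H$ denotes the quaternions with units $e_1,e_2,e_3$; $s_0=\mathrm{Re}(s)$, and $[q]=\{q_0+J|\underline q| : J\in\mathbb S\}$ where $\underline q$ is the imaginary part of $q$ and $\mathbb S$ is the set of imaginary units ($J^2=-1$). $X=X_{\mathbb R}\otimes\mathbb H$ is a two-sided quaternionic Banach module, $X_{\mathbb R}$ a real Banach space; $\mathcal B(X)$ is the space of bounded right linear operators on $X$. For $a\in\mathbb H$ and $T\in\mathcal B(X)$, $(aT)(x)=a\,T(x)$ and $(Ta)(x)=T(ax)$. $\mathcal{BC}(X)\subset\mathcal B(X)$ is the set of operators $T=T_0+T_1e_1+T_2e_2+T_3e_3$ with pairwise commuting components $T_i\in\mathcal B(X_{\mathbb R})$; $\overline T=T_0-T_1e_1-T_2e_2-T_3e_3$. $S$-resolvent set: $\rho_S(T)=\{s\in\mathbb H: (T^2-2\mathrm{Re}(s)T+|s|^2\mathcal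 I)^{-1}\in\mathcal B(X)\}$. For $T\in\mathcal{BC}(X)$ it coincides with the set of $s\in\mathbb H$ for which $\mathcal Q_{c,s}(T):=s^2-s(T+\overline T)+T\overline T$ is invertible in $\mathcal B(X)$. For $s\in\rho_S(T)$: $S^{-1}_L(s,T)=(s\mathcal I-\overline T)\mathcal Q_{c,s}(T)^{-1}$, $S^{-1}_R(s,T)=\mathcal Q_{c,s}(T)^{-1}(s\mathcal I-\overline T)$; $F_L(s,T)=-4(s\mathcal I-\overline T)\mathcal Q_{c,s}(T)^{-2}$, $F_R(s,T)=-4\mathcal Q_{c,s}(T)^{-2}(s\mathcal I-\overline T)$; $\mathcal P^L_2(s,T)=-F_L(s,T)s+T_0F_L(s,T)$, $\mathcal P^R_2(s,T)=-sF_R(s,T)+T_0F_R(s,T)$. *)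

theory Defs
  imports "HOL-Analysis.Analysis"
begin
datatype quat = Quat (qRe: real) (qIm1: real) (qIm2: real) (qIm3: real)

lemma quat_eq_iff:
  "p = q \<longleftrightarrow> qRe p = qRe q \<and> qIm1 p = qIm1 q \<and> qIm2 p = qIm2 q \<and> qIm3 p = qIm3 q"
  by (cases p; cases q) auto

instantiation quat :: real_vector
begin

definition zero_quat :: quat where "0 = Quat 0 0 0 0"

definition plus_quat :: "quat \<Rightarrow> quat \<Rightarrow> quat" where
  "p + q = Quat (qRe p + qRe q) (qIm1 p + qIm1 q) (qIm2 p + qIm2 q) (qIm3 p + qIm3 q)"

definition uminus_quat :: "quat \<Rightarrow> quat" where
  "- p = Quat (- qRe p) (- qIm1 p) (- qIm2 p) (- qIm3 p)"

definition minus_quat :: "quat \<Rightarrow> quat \<Rightarrow> quat" where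
  "p - q = Quat (qRe p - qRe q) (qIm1 p - qIm1 q) (qIm2 p - qIm2 q) (qIm3 p - qIm3 q)"

definition scaleR_quat :: "real \<Rightarrow> quat \<Rightarrow> quat" where
  "r *\<^sub>R q = Quat (r * qRe q) (r * qIm1 q) (r * qIm2 q) (r * qIm3 q)"

instance
  by standard
    (auto simp: quat_eq_iff zero_quat_def plus_quat_def uminus_quat_def minus_quat_def
      scaleR_quat_def algebra_simps)

end

instantiation quat :: real_normed_div_algebra
begin

definition one_quat :: quat where "1 = Quat 1 0 0 0"

text \<open>Hamilton product: \<open>e\<^sub>1\<^sup>2 = e\<^sub>2\<^sup>2 = e\<^sub>3\<^sup>2 = e\<^sub>1 e\<^sub>2 e\<^sub>3 = -1\<close>.\<close>

definition times_quat :: "quat \<Rightarrow> quat \<Rightarrow> quat" where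
  "p * q = Quat
    (qRe p * qRe q - qIm1 p * qIm1 q - qIm2 p * qIm2 q - qIm3 p * qIm3 q)
    (qRe p * qIm1 q + qIm1 p * qRe q + qIm2 p * qIm3 q - qIm3 p * qIm2 q)
    (qRe p * qIm2 q - qIm1 p * qIm3 q + qIm2 p * qRe q + qIm3 p * qIm1 q)
    (qRe p * qIm3 q + qIm1 p * qIm2 q - qIm2 p * qIm1 q + qIm3 p * qRe q)"

definition norm_quat :: "quat \<Rightarrow> real" where
  "norm q = sqrt ((qRe q)\<^sup>2 + (qIm1 q)\<^sup>2 + (qIm2 q)\<^sup>2 + (qIm3 q)\<^sup>2)"

definition inverse_quat :: "quat \<Rightarrow> quat" where
  "inverse q =
    (1 / (norm q)\<^sup>2) *\<^sub>R Quat (qRe q) (- qIm1 q) (- qIm2 q) (- qIm3 q)"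

definition divide_quat :: "quat \<Rightarrow> quat \<Rightarrow> quat" where
  "p div q = p * inverse (q::quat)"

definition sgn_quat_def: "sgn q = q /\<^sub>R norm (q::quat)"

definition dist_quat_def: "dist p q = norm (p - q :: quat)"

definition uniformity_quat_def [code del]:
  "(uniformity :: (quat \<times> quat) filter) = (INF e\<in>{0<..}. principal {(p, q). dist p q < e})"

definition open_quat_def [code del]:
  "open (U :: quat set) \<longleftrightarrow> (\<forall>p\<in>U. eventually (\<lambda>(p', q). p' = p \<longrightarrow> q \<in> U) uniformity)"

lemma norm_quat_prod: "norm q = norm (qRe q, qIm1 q, qIm2 q, qIm3 q)"
  by (simp add: norm_quat_def norm_prod_def add.assoc)

instance
proof
  fix p q r :: quat and a b :: real
  show "(p * q) * r = p * (q * r)" "(p + q) * r = p * r + q * r" "p * (q + r) = p * q + p * r"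
    "1 * p = p" "p * 1 = p" "(0::quat) \<noteq> 1"
    "a *\<^sub>R p * q = a *\<^sub>R (p * q)" "p * a *\<^sub>R q = a *\<^sub>R (p * q)"
    by (simp_all add: quat_eq_iff times_quat_def plus_quat_def one_quat_def zero_quat_def
        scaleR_quat_def algebra_simps)
  show "dist p q = norm (p - q)" "sgn p = p /\<^sub>R norm p" "p div q = p * inverse q"
    by (simp_all add: dist_quat_def sgn_quat_def divide_quat_def)
  show "uniformity = (INF e\<in>{0<..}. principal {(p::quat, q). dist p q < e})"
    by (rule uniformity_quat_def)
  show "open U \<longleftrightarrow> (\<forall>p\<in>U. eventually (\<lambda>(p', q). p' = p \<longrightarrow> q \<in> U) uniformity)"
    for U :: "quat set"
    by (rule open_quat_def)
  show n0: "norm p = 0 \<longleftrightarrow> p = 0"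
    by (simp add: norm_quat_prod quat_eq_iff zero_quat_def prod_eq_iff)
  show "norm (p + q) \<le> norm p + norm q"
    using norm_triangle_ineq[of "(qRe p, qIm1 p, qIm2 p, qIm3 p)" "(qRe q, qIm1 q, qIm2 q, qIm3 q)"]
    by (simp add: norm_quat_prod plus_quat_def)
  show "norm (a *\<^sub>R p) = \<bar>a\<bar> * norm p"
    using norm_scaleR[of a "(qRe p, qIm1 p, qIm2 p, qIm3 p)"]
    by (simp add: norm_quat_prod scaleR_quat_def del: norm_scaleR)
  show "norm (p * q) = norm p * norm q"
    unfolding norm_quat_def real_sqrt_mult[symmetric]
    by (rule arg_cong[where f = sqrt])
      (simp add: times_quat_def power2_eq_square algebra_simps)
  have sq: "(norm p)\<^sup>2 = (qRe p)\<^sup>2 + (qIm1 p)\<^sup>2 + (qIm2 p)\<^sup>2 + (qIm3 p)\<^sup>2"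
    by (simp add: norm_quat_def)
  show "inverse p * p = 1" "p * inverse p = 1" if "p \<noteq> 0"
  proof -
    have "(norm p)\<^sup>2 \<noteq> 0" using that n0 by simp
    then have nz: "(qRe p)\<^sup>2 + (qIm1 p)\<^sup>2 + (qIm2 p)\<^sup>2 + (qIm3 p)\<^sup>2 \<noteq> 0" by (simp add: sq)
    show "inverse p * p = 1" "p * inverse p = 1"
      using nz unfolding inverse_quat_def sq
      by (simp_all add: quat_eq_iff times_quat_def one_quat_def scaleR_quat_def divide_simps)
        (simp_all add: power2_eq_square algebra_simps)
  qed
  show "inverse (0::quat) = 0"
    by (simp add: inverse_quat_def quat_eq_iff scaleR_quat_def zero_quat_def)
qed

end

definition e1 :: quat where "e1 = Quat 0 1 0 0"
definition e2 :: quat where "e2 = Quat 0 0 1 0"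
definition e3 :: quat where "e3 = Quat 0 0 0 1"

definition qcnj :: "quat \<Rightarrow> quat" where
  "qcnj q = Quat (qRe q) (- qIm1 q) (- qIm2 q) (- qIm3 q)"

definition qVec :: "quat \<Rightarrow> quat" where
  "qVec q = Quat 0 (qIm1 q) (qIm2 q) (qIm3 q)"

definition imag_units :: "quat set" where
  "imag_units = {J. J\<^sup>2 = -1}"

definition qsphere :: "quat \<Rightarrow> quat set" where
  "qsphere q = {of_real (qRe q) + J * of_real (norm (qVec q)) |J. J \<in> imag_units}"

definition quatQ :: "quat \<Rightarrow> quat \<Rightarrow> quat" where
  "quatQ s q = q\<^sup>2 - of_real (2 * qRe s) * q + of_real ((norm s)\<^sup>2)"

text \<open>
  The element \<open>x\<^sub>0 + x\<^sub>1 e\<^sub>1 + x\<^sub>2 e\<^sub>2 + x\<^sub>3 e\<^sub>3\<close> of the tensor product of a real Banach space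
  \<open>'a\<close> with the quaternions is represented by \<open>(x\<^sub>0, x\<^sub>1, x\<^sub>2, x\<^sub>3)\<close>.  The product norm of the
  library is the square root of the sum of the squared norms of the \<open>x\<^sub>i\<close>.
\<close>

type_synonym 'a qmod = "'a \<times> 'a \<times> 'a \<times> 'a"

text \<open>Both actions extend the Hamilton product, with real scalars acting on \<open>'a\<close>.\<close>

fun lact :: "quat \<Rightarrow> 'a::real_vector qmod \<Rightarrow> 'a qmod" where
  "lact (Quat a b c d) (x0, x1, x2, x3) =
    (a *\<^sub>R x0 - b *\<^sub>R x1 - c *\<^sub>R x2 - d *\<^sub>R x3,
     a *\<^sub>R x1 + b *\<^sub>R x0 + c *\<^sub>R x3 - d *\<^sub>R x2,
     a *\<^sub>R x2 - b *\<^sub>R x3 + c *\<^sub>R x0 + d *\<^sub>R x1,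
     a *\<^sub>R x3 + b *\<^sub>R x2 - c *\<^sub>R x1 + d *\<^sub>R x0)"

fun ract :: "'a::real_vector qmod \<Rightarrow> quat \<Rightarrow> 'a qmod" where
  "ract (x0, x1, x2, x3) (Quat a b c d) =
    (a *\<^sub>R x0 - b *\<^sub>R x1 - c *\<^sub>R x2 - d *\<^sub>R x3,
     b *\<^sub>R x0 + a *\<^sub>R x1 + d *\<^sub>R x2 - c *\<^sub>R x3,
     c *\<^sub>R x0 - d *\<^sub>R x1 + a *\<^sub>R x2 + b *\<^sub>R x3,
     d *\<^sub>R x0 + c *\<^sub>R x1 - b *\<^sub>R x2 + a *\<^sub>R x3)"

lemma lact_mult: "lact (p * q) x = lact p (lact q x)"
  by (cases p; cases q; cases x) (simp add: times_quat_def algebra_simps)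

lemma ract_mult: "ract x (p * q) = ract (ract x p) q"
  by (cases p; cases q; cases x) (simp add: times_quat_def algebra_simps)

lemma lact_ract: "ract (lact p x) q = lact p (ract x q)"
  by (cases p; cases q; cases x) (simp add: algebra_simps)

lemma lact_one: "lact 1 x = x"
  by (cases x) (simp add: one_quat_def)

lemma ract_one: "ract x 1 = x"
  by (cases x) (simp add: one_quat_def)

type_synonym 'a qop = "'a qmod \<Rightarrow>\<^sub>L 'a qmod"

definition BX :: "'a::banach qop set" where
  "BX = {T. \<forall>x q. blinfun_apply T (ract x q) = ract (blinfun_apply T x) q}"

definition invertible_BX :: "'a::banach qop \<Rightarrow> bool" where
  "invertible_BX A \<longleftrightarrow>
    A \<in> BX \<and> (\<exists>B\<in>BX. B o\<^sub>L A = id_blinfun \<and> A o\<^sub>L B = id_blinfun)"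

definition inv_BX :: "'a::banach qop \<Rightarrow> 'a qop" where
  "inv_BX A = (THE B. B \<in> BX \<and> B o\<^sub>L A = id_blinfun \<and> A o\<^sub>L B = id_blinfun)"

lemma inv_BX_eq:
  assumes "B \<in> BX" "B o\<^sub>L A = id_blinfun" "A o\<^sub>L B = id_blinfun"
  shows "inv_BX A = B"
  unfolding inv_BX_def
proof (rule the_equality)
  fix C assume C: "C \<in> BX \<and> C o\<^sub>L A = id_blinfun \<and> A o\<^sub>L C = id_blinfun"
  have "C = C o\<^sub>L (A o\<^sub>L B)" using assms by (simp add: blinfun_eqI)
  also have "\<dots> = (C o\<^sub>L A) o\<^sub>L B" by (rule blinfun_eqI) simp
  also have "\<dots> = B" using C by (simp add: blinfun_eqI)
  finally show "C = B" .
qed (use assms in simp)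

lift_definition lmult :: "quat \<Rightarrow> 'a::banach qop" is lact
proof -
  fix q :: quat
  obtain a b c d where q: "q = Quat a b c d" by (cases q)
  have "lact q = (\<lambda>x::'a qmod. lact (Quat a b c d) (fst x, fst (snd x), fst (snd (snd x)), snd (snd (snd x))))"
    by (simp add: q fun_eq_iff)
  then show "bounded_linear (lact q :: 'a qmod \<Rightarrow> _)"
    by (simp only: lact.simps) (intro bounded_linear_intros)
qed

text \<open>\<open>a \<rhd> T\<close> and \<open>T \<lhd> a\<close> are the operators \<open>x \<mapsto> a T(x)\<close> and \<open>x \<mapsto> T(a x)\<close>.\<close>

definition lscale :: "quat \<Rightarrow> 'a::banach qop \<Rightarrow> 'a qop" (infixr "\<rhd>" 75) where
  "a \<rhd> T = lmult a o\<^sub>L T"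

definition rscale :: "'a::banach qop \<Rightarrow> quat \<Rightarrow> 'a qop" (infixl "\<lhd>" 75) where
  "T \<lhd> a = T o\<^sub>L lmult a"

text \<open>An operator on the real Banach space acts on the quaternionic module componentwise.\<close>

lift_definition ext :: "('a::banach \<Rightarrow>\<^sub>L 'a) \<Rightarrow> 'a qop" is
  "\<lambda>A (x0, x1, x2, x3). (A x0, A x1, A x2, A x3)"
proof -
  fix A :: "'a \<Rightarrow> 'a" assume A: "bounded_linear A"
  show "bounded_linear (\<lambda>(x0, x1, x2, x3). (A x0, A x1, A x2, A x3))"
    unfolding case_prod_beta
    by (intro bounded_linear_Pair bounded_linear_compose[OF A] bounded_linear_intros)
qed

definition of_comps ::
  "('a::banach \<Rightarrow>\<^sub>L 'a) \<Rightarrow> ('a \<Rightarrow>\<^sub>L 'a) \<Rightarrow> ('a \<Rightarrow>\<^sub>L 'a) \<Rightarrow> ('a \<Rightarrow>\<^sub>L 'a) \<Rightarrow> 'a qop" where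
  "of_comps T0 T1 T2 T3 = ext T0 + ext T1 \<lhd> e1 + ext T2 \<lhd> e2 + ext T3 \<lhd> e3"

text \<open>
  The components of \<open>T\<close> are read off from its values on the real elements \<open>(x, 0, 0, 0)\<close>;
  see \<open>comps_of_comps\<close> and \<open>of_comps_comps\<close>.
\<close>

lift_definition comp0 :: "'a::banach qop \<Rightarrow> ('a \<Rightarrow>\<^sub>L 'a)" is
  "\<lambda>T x. fst (T (x, 0, 0, 0))"
  by (rule bounded_linear_fst_comp, erule bounded_linear_compose)
    (intro bounded_linear_Pair bounded_linear_ident bounded_linear_zero)

lift_definition comp1 :: "'a::banach qop \<Rightarrow> ('a \<Rightarrow>\<^sub>L 'a)" is
  "\<lambda>T x. fst (snd (T (x, 0, 0, 0)))"
  by (rule bounded_linear_fst_comp, rule bounded_linear_snd_comp, erule bounded_linear_compose)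
    (intro bounded_linear_Pair bounded_linear_ident bounded_linear_zero)

lift_definition comp2 :: "'a::banach qop \<Rightarrow> ('a \<Rightarrow>\<^sub>L 'a)" is
  "\<lambda>T x. fst (snd (snd (T (x, 0, 0, 0))))"
  by (rule bounded_linear_fst_comp, rule bounded_linear_snd_comp, rule bounded_linear_snd_comp,
      erule bounded_linear_compose)
    (intro bounded_linear_Pair bounded_linear_ident bounded_linear_zero)

lift_definition comp3 :: "'a::banach qop \<Rightarrow> ('a \<Rightarrow>\<^sub>L 'a)" is
  "\<lambda>T x. snd (snd (snd (T (x, 0, 0, 0))))"
  by (rule bounded_linear_snd_comp, rule bounded_linear_snd_comp, rule bounded_linear_snd_comp,
      erule bounded_linear_compose)
    (intro bounded_linear_Pair bounded_linear_ident bounded_linear_zero)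

lemmas qop_transfer_simps =
  lmult.rep_eq lscale_def rscale_def ext.rep_eq of_comps_def
  comp0.rep_eq comp1.rep_eq comp2.rep_eq comp3.rep_eq e1_def e2_def e3_def

lemma comps_of_comps:
  "comp0 (of_comps T0 T1 T2 T3) = T0" "comp1 (of_comps T0 T1 T2 T3) = T1"
  "comp2 (of_comps T0 T1 T2 T3) = T2" "comp3 (of_comps T0 T1 T2 T3) = T3"
  by (rule blinfun_eqI, simp add: qop_transfer_simps blinfun.bilinear_simps)+

lemma of_comps_in_BX: "of_comps T0 T1 T2 T3 \<in> BX"
proof -
  have "blinfun_apply (of_comps T0 T1 T2 T3) (ract x q) = ract (blinfun_apply (of_comps T0 T1 T2 T3) x) q"
    for x q
    by (cases x; cases q)
      (simp add: qop_transfer_simps blinfun.bilinear_simps algebra_simps)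
  then show ?thesis by (simp add: BX_def)
qed

lemma of_comps_comps:
  assumes "T \<in> BX"
  shows "of_comps (comp0 T) (comp1 T) (comp2 T) (comp3 T) = T"
proof (rule blinfun_eqI)
  let ?S = "of_comps (comp0 T) (comp1 T) (comp2 T) (comp3 T)"
  have zero: "blinfun_apply T (0, 0, 0, 0) = 0"
    using blinfun.zero_right[of T] by (simp add: zero_prod_def)
  have real: "blinfun_apply ?S (x, 0, 0, 0) = blinfun_apply T (x, 0, 0, 0)" for x
    by (simp add: qop_transfer_simps blinfun.bilinear_simps prod_eq_iff zero)
  have act: "blinfun_apply ?S (ract (x, 0, 0, 0) q) = blinfun_apply T (ract (x, 0, 0, 0) q)" for x q
    using assms of_comps_in_BX[of "comp0 T" "comp1 T" "comp2 T" "comp3 T"] real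
    by (simp add: BX_def)
  fix v :: "'a qmod"
  obtain x0 x1 x2 x3 where v: "v = (x0, x1, x2, x3)" by (cases v)
  have "v = ract (x0, 0, 0, 0) 1 + ract (x1, 0, 0, 0) e1 + ract (x2, 0, 0, 0) e2
    + ract (x3, 0, 0, 0) e3"
    by (simp add: v e1_def e2_def e3_def one_quat_def)
  then show "blinfun_apply ?S v = blinfun_apply T v"
    by (simp only: blinfun.add_right act)
qed

definition BC :: "'a::banach qop set" where
  "BC = {of_comps T0 T1 T2 T3 |T0 T1 T2 T3.
    \<forall>A\<in>{T0, T1, T2, T3}. \<forall>B\<in>{T0, T1, T2, T3}. A o\<^sub>L B = B o\<^sub>L A}"

definition conj_op :: "'a::banach qop \<Rightarrow> 'a qop" where
  "conj_op T = ext (comp0 T) - ext (comp1 T) \<lhd> e1 - ext (comp2 T) \<lhd> e2 - ext (comp3 T) \<lhd> e3"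

definition vec_op :: "'a::banach qop \<Rightarrow> 'a qop" where
  "vec_op T = ext (comp1 T) \<lhd> e1 + ext (comp2 T) \<lhd> e2 + ext (comp3 T) \<lhd> e3"

definition S_resolvent_set :: "'a::banach qop \<Rightarrow> quat set" where
  "S_resolvent_set T = {s. invertible_BX
    ((T o\<^sub>L T) - (2 * qRe s) *\<^sub>R T + (norm s)\<^sup>2 *\<^sub>R id_blinfun)}"

text \<open>
  For \<open>T \<in> BC\<close>, \<open>Qc s T\<close> is invertible exactly when \<open>s \<in> S_resolvent_set T\<close>; this is not
  built into the definitions, and \<open>Qc_inv s T\<close> is meaningful only when \<open>Qc s T\<close> is invertible.
\<close>

definition Qc :: "quat \<Rightarrow> 'a::banach qop \<Rightarrow> 'a qop" where
  "Qc s T = s\<^sup>2 \<rhd> id_blinfun - s \<rhd> (T + conj_op T) + (T o\<^sub>L conj_op T)"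

abbreviation Qc_inv :: "quat \<Rightarrow> 'a::banach qop \<Rightarrow> 'a qop" where
  "Qc_inv s T \<equiv> inv_BX (Qc s T)"

definition SL_inv :: "quat \<Rightarrow> 'a::banach qop \<Rightarrow> 'a qop" where
  "SL_inv s T = (s \<rhd> id_blinfun - conj_op T) o\<^sub>L Qc_inv s T"

definition SR_inv :: "quat \<Rightarrow> 'a::banach qop \<Rightarrow> 'a qop" where
  "SR_inv s T = Qc_inv s T o\<^sub>L (s \<rhd> id_blinfun - conj_op T)"

definition FL :: "quat \<Rightarrow> 'a::banach qop \<Rightarrow> 'a qop" where
  "FL s T = (-4) *\<^sub>R ((s \<rhd> id_blinfun - conj_op T) o\<^sub>L (Qc_inv s T o\<^sub>L Qc_inv s T))"

definition FR :: "quat \<Rightarrow> 'a::banach qop \<Rightarrow> 'a qop" where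
  "FR s T = (-4) *\<^sub>R ((Qc_inv s T o\<^sub>L Qc_inv s T) o\<^sub>L (s \<rhd> id_blinfun - conj_op T))"

definition P2L :: "quat \<Rightarrow> 'a::banach qop \<Rightarrow> 'a qop" where
  "P2L s T = - (FL s T \<lhd> s) + (ext (comp0 T) o\<^sub>L FL s T)"

definition P2R :: "quat \<Rightarrow> 'a::banach qop \<Rightarrow> 'a qop" where
  "P2R s T = - (s \<rhd> FR s T) + (ext (comp0 T) o\<^sub>L FR s T)"

end

theory Submission
  imports Defs
begin

text \<open>
  All operators live in one noncommutative ring, in which \<open>a \<rhd> T\<close> and \<open>T \<lhd> a\<close> are the products
  \<open>a T\<close> and \<open>T a\<close>. Put \<open>a = S\<^sub>R\<^sup>-\<^sup>1(s)\<close> and \<open>b = S\<^sub>L\<^sup>-\<^sup>1(q)\<close>, so that \<open>s a = a T + 1\<close> and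
  \<open>b q = T b + 1\<close>. If \<open>M\<close> is the left-hand side, these rules give \<open>M q - s M = P\<^sub>R(s) - P\<^sub>L(q)\<close>, the
  term with the vector part of \<open>T\<close> absorbing the error. Applying \<open>X \<mapsto> X q - s\<^sup>* X\<close> with the conjugate
  \<open>s\<^sup>*\<close> of \<open>s\<close> once more turns the left-hand side into \<open>M Q\<^sub>s(q)\<close>, and \<open>Q\<^sub>s(q) \<noteq> 0\<close> off the sphere of \<open>q\<close>.

  Invertibility of \<open>Q\<^sub>c\<^sub>,\<^sub>s(T)\<close> comes from \<open>Q\<^sub>c\<^sub>,\<^sub>s(T) Q\<^sub>c\<^sub>,\<^sub>s\<^sub>*(T) = p(T) p(T\<^sup>*)\<close> with
  \<open>p(x) = x\<^sup>2 - 2 s\<^sub>0 x + \<bar>s\<bar>\<^sup>2\<close>. Here \<open>p(T\<^sup>*)\<close> is the conjugate of \<open>p(T)\<close>, and conjugation reverses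
  products of operators with mutually commuting components, so it maps the inverse of \<open>p(T)\<close> to that
  of \<open>p(T\<^sup>*)\<close>.
\<close>

section \<open>The ring of bounded endomorphisms\<close>

text \<open>A copy of the bounded endomorphisms, because composition on the two-parameter type of bounded
  operators cannot be declared as a ring multiplication.\<close>

typedef (overloaded) 'a endo = "UNIV :: ('a::real_normed_vector \<Rightarrow>\<^sub>L 'a) set"
  morphisms endo_op Endo ..

setup_lifting type_definition_endo

instantiation endo :: (real_normed_vector) "{real_algebra, monoid_mult}"
begin

lift_definition zero_endo :: "'a endo" is 0 .
lift_definition one_endo :: "'a endo" is id_blinfun .
lift_definition plus_endo :: "'a endo \<Rightarrow> 'a endo \<Rightarrow> 'a endo" is "(+)" .
lift_definition minus_endo :: "'a endo \<Rightarrow> 'a endo \<Rightarrow> 'a endo" is "(-)" .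
lift_definition uminus_endo :: "'a endo \<Rightarrow> 'a endo" is uminus .
lift_definition scaleR_endo :: "real \<Rightarrow> 'a endo \<Rightarrow> 'a endo" is "(*\<^sub>R)" .
lift_definition times_endo :: "'a endo \<Rightarrow> 'a endo \<Rightarrow> 'a endo" is "(o\<^sub>L)" .

instance
  by standard
    (transfer; rule blinfun_eqI; simp add: blinfun.bilinear_simps algebra_simps)+

end

lemma Endo_hom:
  "Endo 0 = 0" "Endo id_blinfun = 1" "Endo (A + B) = Endo A + Endo B"
  "Endo (A - B) = Endo A - Endo B" "Endo (- A) = - Endo A"
  "Endo (r *\<^sub>R A) = r *\<^sub>R Endo A" "Endo (A o\<^sub>L B) = Endo A * Endo B"
  by (simp_all add: zero_endo_def one_endo_def plus_endo.abs_eq minus_endo.abs_eq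
      uminus_endo.abs_eq scaleR_endo.abs_eq times_endo.abs_eq)

lemma Endo_eq_iff: "Endo A = Endo B \<longleftrightarrow> A = B"
  by (simp add: Endo_inject)

section \<open>Identities in abstract rings and monoids\<close>

text \<open>Right-nested products hide the factor \<open>x * y\<close> from a plain commutation
  rule; this form lets the simplifier reorder inside them.\<close>

lemma comm_assoc: "x * y = y * x \<Longrightarrow> x * (y * z) = y * (x * z)"
  for x y z :: "'b::semigroup_mult"
  by (simp flip: mult.assoc)

lemma mult_one_assoc: "x * y = 1 \<Longrightarrow> x * (y * z) = z"
  for x y z :: "'b::monoid_mult"
  by (simp flip: mult.assoc)

lemma inverse_commute:
  fixes C x Z :: "'b::monoid_mult"
  assumes "C * Z = 1" "Z * C = 1" "x * Z = Z * x"
  shows "C * x = x * C"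
proof -
  have "C * x = C * (x * (Z * C))" using assms by simp
  also have "\<dots> = C * (x * Z) * C" by (simp only: mult.assoc)
  also have "\<dots> = C * Z * x * C" by (simp only: assms(3) mult.assoc)
  also have "\<dots> = x * C" using assms by simp
  finally show ?thesis .
qed

text \<open>\<open>M\<close> and the right-hand side are a quarter of those in the header:
  \<open>P\<^sub>R(s)\<close> and \<open>P\<^sub>L(q)\<close> are four times the two terms on the right.\<close>

lemma second_order_resolvent_equation:
  fixes s q t tc t0 v A B :: "'b::{ring, monoid_mult}"
  defines "a \<equiv> A * (s - tc)" and "b \<equiv> (q - tc) * B"
  defines "M \<equiv> a * ((q - tc) * (B * B) * (q - t0)) + (s - t0) * ((A * A) * (s - tc)) * b - A * v * B"
  assumes tc: "t0 - tc = v" and sum: "t + tc = t0 + t0" and tt: "t * tc = tc * t"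
    and t0: "t0 * s = s * t0" "t0 * q = q * t0" "t0 * tc = tc * t0"
    and N: "t * tc * s = s * (t * tc)" "t * tc * q = q * (t * tc)"
    and A: "A * (s * s - s * (t + tc) + t * tc) = 1" "(s * s - s * (t + tc) + t * tc) * A = 1"
    and B: "B * (q * q - q * (t + tc) + t * tc) = 1" "(q * q - q * (t + tc) + t * tc) * B = 1"
  shows "M * q - s * M = (s - t0) * ((A * A) * (s - tc)) - (q - tc) * (B * B) * (q - t0)"
proof -
  define X where "X = s * s - s * (t + tc) + t * tc"
  define Y where "Y = q * q - q * (t + tc) + t * tc"
  have t: "t = t0 + t0 - tc" using sum by (simp add: eq_diff_eq)
  define N where "N = t * tc"
  have t0c: "t0 * (s * z) = s * (t0 * z)" "t0 * (q * z) = q * (t0 * z)"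
    "t0 * (tc * z) = tc * (t0 * z)" for z
    by (simp_all add: t0 comm_assoc)
  have NN: "N * s = s * N" "N * q = q * N" "t0 * N = N * t0"
    using N by (simp_all add: N_def t algebra_simps t0 t0c)
  note comms = NN NN[THEN comm_assoc] t0 t0c
  note AA = A[unfolded sum N_def[symmetric]] and BB = B[unfolded sum N_def[symmetric]]
  \<comment> \<open>With \<open>t + tc\<close> replaced by \<open>t0 + t0\<close>, the quadratics
    inverted by \<open>A\<close> and \<open>B\<close> involve only \<open>t0\<close>,
    \<open>N\<close> and \<open>s\<close> or \<open>q\<close>. These commute with \<open>t0\<close>
    and with \<open>s\<close> or \<open>q\<close> respectively, hence so do the inverses.\<close>
  have As: "A * s = s * A" and At0: "A * t0 = t0 * A"
    by (rule inverse_commute[OF AA]; simp add: algebra_simps comms)+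
  have Bq: "B * q = q * B" and Bt0: "B * t0 = t0 * B"
    by (rule inverse_commute[OF BB]; simp add: algebra_simps comms)+
  note Bc = Bq[THEN comm_assoc] Bt0[THEN comm_assoc]
    and Ac = As[symmetric, THEN comm_assoc] At0[symmetric, THEN comm_assoc]
  have bq: "b * q = t * b + 1"
  proof -
    have "b * q - t * b = ((q - tc) * q - t * (q - tc)) * B"
      by (simp add: b_def algebra_simps Bq)
    \<comment> \<open>The term \<open>(t + tc) * q\<close> must become \<open>q * (t + tc)\<close>;
      this holds because the sum is \<open>t0 + t0\<close>, although \<open>t\<close> and
      \<open>tc\<close> need not commute with \<open>q\<close> one by one.\<close>
    also have "(q - tc) * q - t * (q - tc) = q * q - q * (t + tc) + t * tc"
      by (simp add: sum) (simp add: t algebra_simps t0)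
    finally show ?thesis using B by (simp add: diff_eq_eq add.commute)
  qed
  have sa: "s * a = a * t + 1"
  proof -
    have "s * a - a * t = A * (s * (s - tc) - (s - tc) * t)"
      by (simp add: a_def algebra_simps Ac)
    also have "s * (s - tc) - (s - tc) * t = s * s - s * (t + tc) + t * tc"
      by (simp add: algebra_simps tt)
    finally show ?thesis using A by (simp add: diff_eq_eq add.commute)
  qed
  \<comment> \<open>\<open>K\<close> commutes with \<open>q\<close> and \<open>L\<close> with
    \<open>s\<close>. Splitting the two terms as \<open>b * K\<close> and \<open>L * a\<close>
    therefore lets \<open>q\<close> from the right reach \<open>b\<close>, and \<open>s\<close> from
    the left reach \<open>a\<close>.\<close>
  define K where "K = B * (q - t0)"
  define L where "L = (s - t0) * A"
  have Kq: "K * q = q * K" by (simp add: K_def algebra_simps Bq t0 Bc)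
  have sL: "s * L = L * s" by (simp add: L_def algebra_simps t0c As)
  have P: "(q - tc) * (B * B) * (q - t0) = b * K"
    by (simp add: b_def K_def mult.assoc)
  have R: "(s - t0) * ((A * A) * (s - tc)) = L * a"
    by (simp add: a_def L_def mult.assoc)
  \<comment> \<open>The rules for \<open>b * q\<close> and \<open>s * a\<close> both produce
    \<open>a * t * b * K\<close>, which cancels; the second product below works the same
    way.\<close>
  have "(a * (b * K)) * q - s * (a * (b * K)) = a * (b * q) * K - (s * a) * b * K"
    by (simp add: mult.assoc Kq)
  also have "\<dots> = a * K - b * K"
    by (simp add: bq sa algebra_simps)
  finally have 1: "(a * (b * K)) * q - s * (a * (b * K)) = a * K - b * K" .
  have "(L * a * b) * q - s * (L * a * b) = L * a * (b * q) - L * (s * a) * b"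
    by (simp add: mult.assoc sL[THEN comm_assoc])
  also have "\<dots> = L * a - L * b"
    by (simp add: bq sa algebra_simps)
  finally have 2: "(L * a * b) * q - s * (L * a * b) = L * a - L * b" .
  \<comment> \<open>The two products together give \<open>L * a - b * K\<close> plus the unwanted
    \<open>a * K - L * b\<close>. This remainder is exactly what the term \<open>A * v * B\<close>
    contributes.\<close>
  have "a * K - L * b = A * ((s - tc) * (q - t0) - (s - t0) * (q - tc)) * B"
  proof -
    have "K = (q - t0) * B" by (simp add: K_def algebra_simps Bq Bt0)
    moreover have "L = A * (s - t0)" by (simp add: L_def algebra_simps As At0)
    ultimately show ?thesis by (simp only: a_def b_def right_diff_distrib left_diff_distrib mult.assoc)
  qed
  also have "(s - tc) * (q - t0) - (s - t0) * (q - tc) = v * q - s * v"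
    by (simp add: tc[symmetric] algebra_simps t0)
  also have "A * (v * q - s * v) * B = (A * v * B) * q - s * (A * v * B)"
    by (simp add: algebra_simps Bq As[symmetric, THEN comm_assoc])
  finally have 3: "a * K - L * b = (A * v * B) * q - s * (A * v * B)" .
  have "M * q - s * M = (a * (b * K) * q - s * (a * (b * K))) + (L * a * b * q - s * (L * a * b))
      - ((A * v * B) * q - s * (A * v * B))"
    unfolding M_def P R by (simp add: algebra_simps)
  also have "\<dots> = L * a - b * K"
    by (simp add: 1 2 flip: 3)
  finally show ?thesis by (simp only: P R)
qed

text \<open>For commuting variables both sides are the resultant of two quadratics, one with roots
  \<open>s\<close> and \<open>sc\<close>, the other with roots \<open>t\<close> and
  \<open>tc\<close>. Here \<open>s\<close> and \<open>sc\<close> commute with the sum and product of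
  \<open>t\<close> and \<open>tc\<close>, but not necessarily with each of them, so both sides are
  compared as polynomials in the sums and products of the two pairs.\<close>

lemma quadratic_conj_factorization:
  fixes s sc t tc r n :: "'b::{ring, monoid_mult}"
  assumes s: "s + sc = r" "s * sc = n" "sc * s = n"
    and tt: "t * tc = tc * t"
    and sum: "(t + tc) * s = s * (t + tc)" "(t + tc) * sc = sc * (t + tc)"
    and N: "t * tc * s = s * (t * tc)" "t * tc * sc = sc * (t * tc)"
    and r: "r * t = t * r" "r * tc = tc * r" and n: "n * t = t * n" "n * tc = tc * n"
  shows "(s * s - s * (t + tc) + t * tc) * (sc * sc - sc * (t + tc) + t * tc)
    = (t * t - r * t + n) * (tc * tc - r * tc + n)"
proof -
  define a where "a = t + tc"
  define N where "N = t * tc"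
  have sn: "s * n = n * s" "sc * n = n * sc" by (metis s(2,3) mult.assoc)+
  have comms: "a * s = s * a" "a * sc = sc * a" "N * s = s * N" "N * sc = sc * N"
    "t * n = n * t" "tc * n = n * tc" "t * r = r * t" "tc * r = r * tc" "tc * t = t * tc"
    "r * n = n * r"
    using sum N r n sn tt by (simp_all add: a_def N_def algebra_simps flip: s(1))
  have aN: "N * a = a * N" "a * n = n * a" "N * n = n * N"
    by (simp_all add: N_def a_def algebra_simps comms comms[THEN comm_assoc])
  have s': "s * (sc * x) = n * x" "sc * (s * x) = n * x" for x
    by (simp_all flip: mult.assoc add: s)
  have sq: "s * s + sc * sc = r * r - (n + n)"
  proof -
    have "r * r = s * s + n + (n + sc * sc)"
      unfolding s(1)[symmetric] by (simp add: algebra_simps s(2,3))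
    then show ?thesis by simp
  qed
  have "(s * s - s * a + N) * (sc * sc - sc * a + N)
     = n * n - n * ((s + sc) * a) + (s * s + sc * sc) * N + n * a * a - (s + sc) * a * N + N * N"
    by (simp add: algebra_simps s(2,3) s' comms(1-4) comms(1-4)[THEN comm_assoc]
        aN aN[THEN comm_assoc] sn sn[THEN comm_assoc])
  also have "\<dots> = n * n - n * (r * a) + (r * r - (n + n)) * N + n * a * a - r * a * N + N * N"
    by (simp only: s sq)
  also have "\<dots> = (t * t - r * t + n) * (tc * tc - r * tc + n)"
    by (simp add: a_def N_def algebra_simps comms(5-) comms(5-)[THEN comm_assoc])
  finally show ?thesis by (simp add: a_def N_def)
qed

text \<open>\<open>Q' * R\<close> is a right inverse of \<open>Q\<close> and \<open>R * Q'\<close> a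
  left inverse, so the two agree.\<close>

lemma inverse_of_commuting_factor:
  fixes Q Q' P R :: "'b::monoid_mult"
  assumes "Q * Q' = P" "Q' * Q = P" "P * R = 1" "R * P = 1"
  shows "Q * (Q' * R) = 1" "(Q' * R) * Q = 1"
proof -
  show r: "Q * (Q' * R) = 1" using assms by (simp flip: mult.assoc)
  have "(R * Q') * Q = 1" using assms by (simp add: mult.assoc)
  then have "R * Q' = Q' * R" using r by (metis mult.assoc mult.left_neutral mult.right_neutral)
  then show "(Q' * R) * Q = 1" using \<open>(R * Q') * Q = 1\<close> by simp
qed

section \<open>Left multiplications and right linear operators\<close>

lemma lmult_mult: "lmult (p * q) = lmult p o\<^sub>L lmult q"
  by (rule blinfun_eqI) (simp add: lmult.rep_eq lact_mult)

lemma lmult_of_real: "lmult (of_real r) = r *\<^sub>R id_blinfun"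
proof (rule blinfun_eqI)
  fix x :: "'a qmod"
  show "blinfun_apply (lmult (of_real r)) x = blinfun_apply (r *\<^sub>R id_blinfun) x"
    by (cases x) (simp add: lmult.rep_eq of_real_def one_quat_def scaleR_quat_def blinfun.bilinear_simps)
qed

lemma lmult_add: "lmult (p + q) = lmult p + lmult q"
proof (rule blinfun_eqI)
  fix x :: "'a qmod"
  show "blinfun_apply (lmult (p + q)) x = blinfun_apply (lmult p + lmult q) x"
    by (cases x; cases p; cases q)
      (simp add: lmult.rep_eq plus_quat_def blinfun.bilinear_simps algebra_simps)
qed

lemma lmult_diff: "lmult (p - q) = lmult p - lmult q"
  by (metis add_diff_cancel_right' diff_add_cancel lmult_add)

lemma ext_lmult: "ext A o\<^sub>L lmult q = lmult q o\<^sub>L ext A"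
proof (rule blinfun_eqI)
  fix x :: "'a qmod"
  show "blinfun_apply (ext A o\<^sub>L lmult q) x = blinfun_apply (lmult q o\<^sub>L ext A) x"
    by (cases x; cases q) (simp add: lmult.rep_eq ext.rep_eq blinfun.bilinear_simps)
qed

lemma ract_add: "ract (x + y) q = ract x q + ract y q"
  by (cases x; cases y; cases q) (simp add: algebra_simps)

lemma ract_scaleR: "ract (r *\<^sub>R x) q = r *\<^sub>R ract x q"
  by (cases x; cases q) (simp add: algebra_simps)

lemma BX_scaleR: "A \<in> BX \<Longrightarrow> r *\<^sub>R A \<in> BX"
  by (simp add: BX_def blinfun.bilinear_simps ract_scaleR)

lemma BX_add: "A \<in> BX \<Longrightarrow> B \<in> BX \<Longrightarrow> A + B \<in> BX"
  by (simp add: BX_def blinfun.bilinear_simps ract_add)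

lemma BX_diff: "A \<in> BX \<Longrightarrow> B \<in> BX \<Longrightarrow> A - B \<in> BX"
  using BX_add[of A "(-1) *\<^sub>R B"] BX_scaleR[of B "-1"] by simp

lemma BX_compose: "A \<in> BX \<Longrightarrow> B \<in> BX \<Longrightarrow> A o\<^sub>L B \<in> BX"
  by (simp add: BX_def del: split_paired_All)

lemma BX_id: "id_blinfun \<in> BX"
  by (simp add: BX_def)

lemma BX_lmult: "lmult q \<in> BX"
  by (simp add: BX_def lmult.rep_eq lact_ract)

section \<open>Components and conjugation of operators\<close>

lemma ext_add: "ext (A + B) = ext A + ext B"
proof (rule blinfun_eqI)
  fix x :: "'a qmod"
  show "blinfun_apply (ext (A + B)) x = blinfun_apply (ext A + ext B) x"
    by (cases x) (simp add: ext.rep_eq blinfun.bilinear_simps)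
qed

lemma ext_scaleR: "ext (r *\<^sub>R A) = r *\<^sub>R ext A"
proof (rule blinfun_eqI)
  fix x :: "'a qmod"
  show "blinfun_apply (ext (r *\<^sub>R A)) x = blinfun_apply (r *\<^sub>R ext A) x"
    by (cases x) (simp add: ext.rep_eq blinfun.bilinear_simps)
qed

lemma conj_op_of_comps: "conj_op (of_comps A B C D) = of_comps A (- B) (- C) (- D)"
proof -
  have "ext (- E) = - ext E" for E :: "'a \<Rightarrow>\<^sub>L 'a"
    using ext_scaleR[of "-1" E] by simp
  then show ?thesis
    by (simp add: conj_op_def comps_of_comps, simp add: of_comps_def rscale_def
        bounded_bilinear.minus_left[OF bounded_bilinear_blinfun_compose])
qed

lemma comp_add:
  "comp0 (S + T) = comp0 S + comp0 T" "comp1 (S + T) = comp1 S + comp1 T"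
  "comp2 (S + T) = comp2 S + comp2 T" "comp3 (S + T) = comp3 S + comp3 T"
  by (rule blinfun_eqI;
      simp add: comp0.rep_eq comp1.rep_eq comp2.rep_eq comp3.rep_eq blinfun.bilinear_simps)+

lemma comp_scaleR:
  "comp0 (r *\<^sub>R T) = r *\<^sub>R comp0 T" "comp1 (r *\<^sub>R T) = r *\<^sub>R comp1 T"
  "comp2 (r *\<^sub>R T) = r *\<^sub>R comp2 T" "comp3 (r *\<^sub>R T) = r *\<^sub>R comp3 T"
  by (rule blinfun_eqI;
      simp add: comp0.rep_eq comp1.rep_eq comp2.rep_eq comp3.rep_eq blinfun.bilinear_simps)+

lemma conj_op_add: "conj_op (S + T) = conj_op S + conj_op T"
  by (simp add: conj_op_def comp_add ext_add rscale_def
      bounded_bilinear.add_left[OF bounded_bilinear_blinfun_compose])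

lemma conj_op_scaleR: "conj_op (r *\<^sub>R T) = r *\<^sub>R conj_op T"
  by (simp add: conj_op_def comp_scaleR ext_scaleR rscale_def scaleR_diff_right
      bounded_bilinear.scaleR_left[OF bounded_bilinear_blinfun_compose])

lemma conj_op_diff: "conj_op (S - T) = conj_op S - conj_op T"
  by (metis conj_op_add add_diff_cancel_right' diff_add_cancel)

lemma conj_op_BX: "T \<in> BX \<Longrightarrow> conj_op T \<in> BX"
  by (metis of_comps_comps conj_op_of_comps of_comps_in_BX)

lemma blinfun_compose_commute_apply:
  "A o\<^sub>L B = B o\<^sub>L A \<Longrightarrow> blinfun_apply A (blinfun_apply B x) = blinfun_apply B (blinfun_apply A x)"
  by (metis blinfun_apply_blinfun_compose)

text \<open>Values at real elements \<open>(x, 0, 0, 0)\<close> isolate the components of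
  \<open>U\<close>; conversely, \<open>ext A\<close> commutes with all left multiplications, so only
  those components matter. Since the right-hand side is symmetric in \<open>A\<close> and
  \<open>C\<close>, commutation can be passed between the components of two operators.\<close>

lemma ext_commute_iff:
  assumes "U \<in> BX"
  shows "ext A o\<^sub>L U = U o\<^sub>L ext A \<longleftrightarrow> (\<forall>C\<in>{comp0 U, comp1 U, comp2 U, comp3 U}. A o\<^sub>L C = C o\<^sub>L A)"
proof
  assume c: "ext A o\<^sub>L U = U o\<^sub>L ext A"
  have "blinfun_apply (ext A) (blinfun_apply U (x, 0, 0, 0)) = blinfun_apply U (blinfun_apply A x, 0, 0, 0)" for x
    using blinfun_compose_commute_apply[OF c, of "(x, 0, 0, 0)"]
    by (simp add: ext.rep_eq blinfun.bilinear_simps)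
  then have "blinfun_apply (A o\<^sub>L C) x = blinfun_apply (C o\<^sub>L A) x"
    if "C \<in> {comp0 U, comp1 U, comp2 U, comp3 U}" for C x
    using that by (auto simp: ext.rep_eq comp0.rep_eq comp1.rep_eq comp2.rep_eq comp3.rep_eq
        prod_eq_iff case_prod_beta)
  then show "\<forall>C\<in>{comp0 U, comp1 U, comp2 U, comp3 U}. A o\<^sub>L C = C o\<^sub>L A"
    by (blast intro: blinfun_eqI)
next
  assume c: "\<forall>C\<in>{comp0 U, comp1 U, comp2 U, comp3 U}. A o\<^sub>L C = C o\<^sub>L A"
  then have *: "ext A o\<^sub>L ext C = ext C o\<^sub>L ext A" if "C \<in> {comp0 U, comp1 U, comp2 U, comp3 U}" for C
    using that by (intro blinfun_eqI)
      (auto simp: ext.rep_eq blinfun_compose_commute_apply split: prod.splits)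
  have c: "Endo (ext A) * Endo (ext C) = Endo (ext C) * Endo (ext A)"
    if "C \<in> {comp0 U, comp1 U, comp2 U, comp3 U}" for C
    by (simp only: *[OF that] flip: Endo_hom(7))
  have e: "Endo (ext A) * Endo (lmult p) = Endo (lmult p) * Endo (ext A)" for p
    by (simp only: ext_lmult flip: Endo_hom(7))
  have U: "Endo U = Endo (ext (comp0 U)) + Endo (ext (comp1 U)) * Endo (lmult e1)
    + Endo (ext (comp2 U)) * Endo (lmult e2) + Endo (ext (comp3 U)) * Endo (lmult e3)"
    using of_comps_comps[OF assms] by (metis of_comps_def rscale_def Endo_hom(3,7))
  have "Endo (ext A) * Endo U = Endo U * Endo (ext A)"
    by (simp add: U algebra_simps c c[THEN comm_assoc] e)
  then show "ext A o\<^sub>L U = U o\<^sub>L ext A"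
    by (simp flip: Endo_hom(7) add: Endo_eq_iff)
qed

text \<open>Quaternionic conjugation reverses products, and this persists for operator coefficients
  once every component of \<open>U\<close> commutes with every component of
  \<open>V\<close>.\<close>

lemma conj_op_compose:
  assumes "U \<in> BX" "V \<in> BX"
    and "\<And>C. C \<in> {comp0 U, comp1 U, comp2 U, comp3 U} \<Longrightarrow> ext C o\<^sub>L V = V o\<^sub>L ext C"
  shows "conj_op (U o\<^sub>L V) = conj_op V o\<^sub>L conj_op U"
proof -
  obtain U0 U1 U2 U3 where U: "U = of_comps U0 U1 U2 U3" using assms(1) by (metis of_comps_comps)
  obtain V0 V1 V2 V3 where V: "V = of_comps V0 V1 V2 V3" using assms(2) by (metis of_comps_comps)
  have "C o\<^sub>L D = D o\<^sub>L C" if "C \<in> {U0, U1, U2, U3}" "D \<in> {V0, V1, V2, V3}" for C D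
    using assms(3)[of C] that ext_commute_iff[OF assms(2), of C] by (auto simp: U V comps_of_comps)
  then have c: "blinfun_apply C (blinfun_apply D x) = blinfun_apply D (blinfun_apply C x)"
    if "C \<in> {U0, U1, U2, U3}" "D \<in> {V0, V1, V2, V3}" for C D x
    using that blinfun_compose_commute_apply by blast
  note c' = c[of U0 V0] c[of U0 V1] c[of U0 V2] c[of U0 V3] c[of U1 V0] c[of U1 V1] c[of U1 V2] c[of U1 V3]
    c[of U2 V0] c[of U2 V1] c[of U2 V2] c[of U2 V3] c[of U3 V0] c[of U3 V1] c[of U3 V2] c[of U3 V3]
  show ?thesis
  proof (rule blinfun_eqI)
    fix x :: "'a qmod"
    show "blinfun_apply (conj_op (U o\<^sub>L V)) x = blinfun_apply (conj_op V o\<^sub>L conj_op U) x"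
      by (cases x) (simp add: U V conj_op_of_comps, simp add: conj_op_def qop_transfer_simps blinfun.bilinear_simps c' algebra_simps)
  qed
qed

lemma conj_op_alt: "conj_op T = ext (comp0 T) - vec_op T"
  by (simp add: conj_op_def vec_op_def algebra_simps)

lemma add_conj_op:
  assumes "T \<in> BX"
  shows "T + conj_op T = ext (comp0 T) + ext (comp0 T)"
proof -
  have "T = ext (comp0 T) + vec_op T"
    using of_comps_comps[OF assms] by (simp add: of_comps_def vec_op_def algebra_simps)
  then have "vec_op T = T - ext (comp0 T)" by (simp add: eq_diff_eq add.commute)
  then show ?thesis by (simp add: conj_op_alt)
qed

lemma BC_BX: "T \<in> BC \<Longrightarrow> T \<in> BX"
  by (auto simp: BC_def of_comps_in_BX)

lemma BC_ext_commute:
  assumes "T \<in> BC" "C \<in> {comp0 T, comp1 T, comp2 T, comp3 T}"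
  shows "ext C o\<^sub>L T = T o\<^sub>L ext C"
  using assms ext_commute_iff[OF BC_BX[OF assms(1)], of C]
  by (auto simp: BC_def comps_of_comps)

text \<open>Commutation cancels the vector part, and both products reduce to the sum of the squared
  components. What matters later is that both are the same extension \<open>ext A\<close>, hence
  equal and commuting with left multiplications.\<close>

lemma BC_compose_conj_op:
  assumes "T \<in> BC"
  obtains A where "T o\<^sub>L conj_op T = ext A" "conj_op T o\<^sub>L T = ext A"
proof -
  obtain T0 T1 T2 T3 where T: "T = of_comps T0 T1 T2 T3"
    and "\<forall>A\<in>{T0, T1, T2, T3}. \<forall>B\<in>{T0, T1, T2, T3}. A o\<^sub>L B = B o\<^sub>L A"
    using assms by (auto simp: BC_def)
  then have c: "blinfun_apply C (blinfun_apply D x) = blinfun_apply D (blinfun_apply C x)"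
    if "C \<in> {T0, T1, T2, T3}" "D \<in> {T0, T1, T2, T3}" for C D x
    using that blinfun_compose_commute_apply by blast
  note c' = c[of T1 T0] c[of T2 T0] c[of T3 T0] c[of T2 T1] c[of T3 T1] c[of T3 T2]
  define A where "A = (T0 o\<^sub>L T0) + (T1 o\<^sub>L T1) + (T2 o\<^sub>L T2) + (T3 o\<^sub>L T3)"
  have "blinfun_apply (T o\<^sub>L conj_op T) x = blinfun_apply (ext A) x"
    "blinfun_apply (conj_op T o\<^sub>L T) x = blinfun_apply (ext A) x" for x
    by (cases x; simp add: T conj_op_of_comps;
        simp add: A_def qop_transfer_simps blinfun.bilinear_simps c' algebra_simps)+
  then show ?thesis by (intro that blinfun_eqI)
qed

section \<open>Quaternion conjugates and spheres\<close>

lemma qcnj_simps: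
  "s + qcnj s = of_real (2 * qRe s)" "s * qcnj s = of_real ((norm s)\<^sup>2)" "qcnj s * s = of_real ((norm s)\<^sup>2)"
  by (simp_all add: qcnj_def plus_quat_def times_quat_def norm_quat_def of_real_def one_quat_def
      scaleR_quat_def quat_eq_iff power2_eq_square)

text \<open>If \<open>quatQ s q\<close> vanishes, \<open>q\<close> and \<open>s\<close> share their
  real part and the norm of their vector part, which puts \<open>s\<close> on the sphere of
  \<open>q\<close>.\<close>

lemma quatQ_nonzero:
  assumes "s \<notin> qsphere q"
  shows "quatQ s q \<noteq> 0"
proof
  assume "quatQ s q = 0"
  moreover obtain s0 s1 s2 s3 where s: "s = Quat s0 s1 s2 s3" by (cases s)
  moreover obtain q0 q1 q2 q3 where q: "q = Quat q0 q1 q2 q3" by (cases q)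
  ultimately have 0: "q0\<^sup>2 - (q1\<^sup>2 + q2\<^sup>2 + q3\<^sup>2) - 2 * s0 * q0 + (s0\<^sup>2 + s1\<^sup>2 + s2\<^sup>2 + s3\<^sup>2) = 0"
    and v: "(q0 - s0) * q1 = 0" "(q0 - s0) * q2 = 0" "(q0 - s0) * q3 = 0"
    by (simp_all add: quatQ_def plus_quat_def times_quat_def norm_quat_def of_real_def one_quat_def
      scaleR_quat_def minus_quat_def zero_quat_def quat_eq_iff power2_eq_square algebra_simps)
  \<comment> \<open>If \<open>q0\<close> differed from \<open>s0\<close>, the vector part of
    \<open>q\<close> would vanish and the real part would be a sum of squares containing
    \<open>(q0 - s0)\<^sup>2\<close>, which cannot be zero.\<close>
  have eq: "q0 = s0 \<and> q1\<^sup>2 + q2\<^sup>2 + q3\<^sup>2 = s1\<^sup>2 + s2\<^sup>2 + s3\<^sup>2"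
  proof (cases "q0 = s0")
    case True
    then show ?thesis using 0 by (simp add: power2_eq_square algebra_simps)
  next
    case False
    then have "q1 = 0" "q2 = 0" "q3 = 0" using v by auto
    moreover from this have "(q0 - s0)\<^sup>2 + (s1\<^sup>2 + s2\<^sup>2 + s3\<^sup>2) = 0"
      using 0 by (simp add: power2_eq_square algebra_simps)
    ultimately show ?thesis
      by (smt (verit) zero_le_power2 power2_eq_iff_nonneg zero_eq_power2)
  qed
  define m where "m = norm (qVec q)"
  have m: "m = sqrt (s1\<^sup>2 + s2\<^sup>2 + s3\<^sup>2)"
    using eq by (simp add: m_def q qVec_def norm_quat_def)
  then have m2: "m * m = s1\<^sup>2 + s2\<^sup>2 + s3\<^sup>2" by (simp add: real_sqrt_mult_self)
  \<comment> \<open>The normalised vector part of \<open>s\<close>; if that part is zero any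
    imaginary unit serves, and \<open>e1\<close> is taken.\<close>
  define J where "J = (if m = 0 then e1 else (1 / m) *\<^sub>R qVec s)"
  have "J\<^sup>2 = - 1"
  proof (cases "m = 0")
    case True
    then show ?thesis
      by (simp add: J_def e1_def power2_eq_square times_quat_def uminus_quat_def one_quat_def)
  next
    case False
    then have "s1 * s1 / (m * m) + s2 * s2 / (m * m) + s3 * s3 / (m * m) = 1"
      by (simp flip: add_divide_distrib m2[unfolded power2_eq_square])
    with False show ?thesis
      by (simp add: J_def s qVec_def power2_eq_square times_quat_def uminus_quat_def one_quat_def
          scaleR_quat_def)
  qed
  moreover have "s = of_real (qRe q) + J * of_real m"
  proof (cases "m = 0")
    case True
    then have "s1\<^sup>2 + s2\<^sup>2 + s3\<^sup>2 = 0" using m2 by simp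
    then have "s1 = 0 \<and> s2 = 0 \<and> s3 = 0"
      by (smt (verit) zero_le_power2 zero_eq_power2)
    then show ?thesis using True eq
      by (simp add: s q of_real_def one_quat_def scaleR_quat_def flip: zero_quat_def)
  next
    case False
    then show ?thesis using eq
      by (simp add: J_def s q qVec_def of_real_def one_quat_def scaleR_quat_def times_quat_def
          plus_quat_def)
  qed
  ultimately have "s \<in> qsphere q"
    unfolding qsphere_def imag_units_def m_def by blast
  with assms show False by contradiction
qed

section \<open>Invertibility of \<open>Qc\<close> on the S-resolvent set\<close>

text \<open>\<open>inv_BX\<close> is a definite description, so an inverse has to be exhibited: it
  is \<open>Qc (qcnj s) T\<close> composed with \<open>conj_op R\<close> and \<open>R\<close>, where
  \<open>R\<close> inverts p(T).\<close>

lemma Qc_inverse: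
  fixes T :: "'a::banach qop"
  assumes T: "T \<in> BC" and s: "s \<in> S_resolvent_set T"
  shows "Qc_inv s T o\<^sub>L Qc s T = id_blinfun" "Qc s T o\<^sub>L Qc_inv s T = id_blinfun"
proof -
  have TX: "T \<in> BX" by (rule BC_BX[OF T])
  define p where "p = (T o\<^sub>L T) - (2 * qRe s) *\<^sub>R T + (norm s)\<^sup>2 *\<^sub>R id_blinfun"
  obtain R where R: "R \<in> BX" "R o\<^sub>L p = id_blinfun" "p o\<^sub>L R = id_blinfun" and pX: "p \<in> BX"
    using s by (auto simp: S_resolvent_set_def invertible_BX_def p_def)
  have p_comm: "ext C o\<^sub>L p = p o\<^sub>L ext C" if "ext C o\<^sub>L T = T o\<^sub>L ext C" for C
  proof -
    have c: "Endo (ext C) * Endo T = Endo T * Endo (ext C)"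
      by (simp only: that flip: Endo_hom(7))
    have "Endo (ext C) * Endo p = Endo p * Endo (ext C)"
      by (simp add: p_def Endo_hom algebra_simps c c[THEN comm_assoc])
    then show ?thesis by (simp flip: Endo_hom(7) add: Endo_eq_iff)
  qed
  have R_comm: "ext C o\<^sub>L R = R o\<^sub>L ext C" if "ext C o\<^sub>L p = p o\<^sub>L ext C" for C
  proof -
    have c: "Endo (ext C) * Endo p = Endo p * Endo (ext C)"
      by (simp only: that flip: Endo_hom(7))
    have R': "Endo R * Endo p = 1" "Endo p * Endo R = 1"
      by (simp_all only: R Endo_hom(2) flip: Endo_hom(7))
    from inverse_commute[OF this c]
    show ?thesis by (simp flip: Endo_hom(7) add: Endo_eq_iff)
  qed
  have TR: "ext C o\<^sub>L R = R o\<^sub>L ext C" if "C \<in> {comp0 T, comp1 T, comp2 T, comp3 T}" for C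
    using BC_ext_commute[OF T that] R_comm p_comm by blast
  \<comment> \<open>The components of \<open>T\<close> commute with \<open>R\<close>, hence with the
    components of \<open>R\<close>; reading the criterion backwards, the latter commute with
    \<open>T\<close>.\<close>
  have RT: "ext C o\<^sub>L T = T o\<^sub>L ext C" if "C \<in> {comp0 R, comp1 R, comp2 R, comp3 R}" for C
    unfolding ext_commute_iff[OF TX] using TR that ext_commute_iff[OF R(1)] by metis
  have Rp: "ext C o\<^sub>L p = p o\<^sub>L ext C" if "C \<in> {comp0 R, comp1 R, comp2 R, comp3 R}" for C
    using RT[OF that] p_comm by blast
  have pR: "ext C o\<^sub>L R = R o\<^sub>L ext C" if "C \<in> {comp0 p, comp1 p, comp2 p, comp3 p}" for C
    unfolding ext_commute_iff[OF R(1)] using Rp that ext_commute_iff[OF pX] by metis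
  have conj_id: "conj_op id_blinfun = (id_blinfun :: 'a qop)"
  proof (rule blinfun_eqI)
    fix x :: "'a qmod"
    show "blinfun_apply (conj_op id_blinfun) x = blinfun_apply id_blinfun x"
      by (cases x) (simp add: conj_op_def qop_transfer_simps blinfun.bilinear_simps)
  qed
  have conj_lin: "conj_op (A - r *\<^sub>R B + t *\<^sub>R C) = conj_op A - r *\<^sub>R conj_op B + t *\<^sub>R conj_op C"
    for A B C :: "'a qop" and r t
    by (simp add: conj_op_diff conj_op_scaleR conj_op_add)
  define T' where "T' = conj_op T"
  define p' where "p' = (T' o\<^sub>L T') - (2 * qRe s) *\<^sub>R T' + (norm s)\<^sup>2 *\<^sub>R id_blinfun"
  have p': "p' = conj_op p"
    using conj_op_compose[OF TX TX BC_ext_commute[OF T]]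
    by (simp add: p_def p'_def conj_lin conj_id T'_def)
  \<comment> \<open>Conjugating both \<open>R o\<^sub>L p = id_blinfun\<close> and
    \<open>p o\<^sub>L R = id_blinfun\<close> gives a two-sided inverse; \<open>Rp\<close> and
    \<open>pR\<close> supply the commutation for the two orders.\<close>
  have R': "p' o\<^sub>L conj_op R = id_blinfun" "conj_op R o\<^sub>L p' = id_blinfun"
    using conj_op_compose[OF R(1) pX Rp] conj_op_compose[OF pX R(1) pR] R conj_id
    by (simp_all add: p')
  obtain A where A: "T o\<^sub>L T' = ext A" "T' o\<^sub>L T = ext A"
    using BC_compose_conj_op[OF T] unfolding T'_def by metis
  define i where "i = (\<lambda>q. Endo (lmult q :: 'a qop))"
  have Q: "Endo (Qc q T) = i q * i q - i q * (Endo T + Endo T') + Endo T * Endo T'" for q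
    by (simp add: Qc_def i_def lscale_def lmult_mult Endo_hom power2_eq_square T'_def)
  have i: "i s + i (qcnj s) = (2 * qRe s) *\<^sub>R 1" "i s * i (qcnj s) = ((norm s)\<^sup>2) *\<^sub>R 1"
    "i (qcnj s) * i s = ((norm s)\<^sup>2) *\<^sub>R 1"
    by (simp_all only: i_def qcnj_simps lmult_of_real Endo_hom(2,6)
        flip: Endo_hom(3,7) lmult_add lmult_mult)
  have ext_i: "Endo (ext C) * i q = i q * Endo (ext C)" for C q
    by (simp only: i_def ext_lmult flip: Endo_hom(7))
  have sum: "(Endo T + Endo T') * i q = i q * (Endo T + Endo T')" for q
  proof -
    have "Endo T + Endo T' = Endo (ext (comp0 T)) + Endo (ext (comp0 T))"
      by (simp only: T'_def add_conj_op[OF TX] flip: Endo_hom(3))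
    then show ?thesis by (simp add: ext_i algebra_simps)
  qed
  have N: "Endo T * Endo T' * i q = i q * (Endo T * Endo T')" for q
    by (simp only: A ext_i flip: Endo_hom(7))
  have TT: "Endo T * Endo T' = Endo T' * Endo T"
    by (simp only: A flip: Endo_hom(7))
  note aux = quadratic_conj_factorization[OF _ _ _ TT sum sum N N, where r = "(2 * qRe s) *\<^sub>R 1" and n = "((norm s)\<^sup>2) *\<^sub>R 1"]
  define P where "P = Endo p * Endo p'"
  have Pp: "P = (Endo T * Endo T - (2 * qRe s) *\<^sub>R 1 * Endo T + ((norm s)\<^sup>2) *\<^sub>R 1)
    * (Endo T' * Endo T' - (2 * qRe s) *\<^sub>R 1 * Endo T' + ((norm s)\<^sup>2) *\<^sub>R 1)"
    by (simp add: P_def p_def p'_def Endo_hom)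
  \<comment> \<open>Exchanging \<open>s\<close> with its conjugate preserves the real scalars
    \<open>r\<close> and \<open>n\<close>, so the factorization holds in both orders with the same
    \<open>P\<close>.\<close>
  have QQ: "Endo (Qc s T) * Endo (Qc (qcnj s) T) = P" "Endo (Qc (qcnj s) T) * Endo (Qc s T) = P"
    unfolding Q Pp by (rule aux; simp add: i add.commute)+
  have PR: "P * Endo (conj_op R o\<^sub>L R) = 1" "Endo (conj_op R o\<^sub>L R) * P = 1"
  proof -
    have *: "Endo p * Endo R = 1" "Endo R * Endo p = 1" "Endo p' * Endo (conj_op R) = 1"
      "Endo (conj_op R) * Endo p' = 1"
      by (simp_all only: R R' Endo_hom(2) flip: Endo_hom(7))
    show "P * Endo (conj_op R o\<^sub>L R) = 1" "Endo (conj_op R o\<^sub>L R) * P = 1"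
      by (simp_all add: P_def Endo_hom mult.assoc * *[THEN mult_one_assoc])
  qed
  define B where "B = Qc (qcnj s) T o\<^sub>L (conj_op R o\<^sub>L R)"
  have "B \<in> BX"
    unfolding B_def Qc_def lscale_def
    by (intro BX_compose BX_add BX_diff BX_lmult BX_id TX conj_op_BX R)
  moreover have "B o\<^sub>L Qc s T = id_blinfun" "Qc s T o\<^sub>L B = id_blinfun"
    using inverse_of_commuting_factor[OF QQ PR] by (simp_all add: B_def Endo_hom flip: Endo_eq_iff)
  ultimately show "Qc_inv s T o\<^sub>L Qc s T = id_blinfun" "Qc s T o\<^sub>L Qc_inv s T = id_blinfun"
    by (simp_all add: inv_BX_eq)
qed

section \<open>From the ring identity to the operator equation\<close>

theorem theorem4p2:
  fixes T :: "'a::banach qop" and q s :: quat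
  assumes "T \<in> BC"
    and "q \<in> S_resolvent_set T" and "s \<in> S_resolvent_set T"
    and "s \<notin> qsphere q"
  shows "(SR_inv s T o\<^sub>L P2L q T) + (P2R s T o\<^sub>L SL_inv q T)
      - 4 *\<^sub>R (Qc_inv s T o\<^sub>L vec_op T o\<^sub>L Qc_inv q T)
    = ((P2R s T - P2L q T) \<lhd> q - qcnj s \<rhd> (P2R s T - P2L q T)) \<lhd> inverse (quatQ s q)"
proof -
  have TX: "T \<in> BX" by (rule BC_BX[OF assms(1)])
  define i where "i = (\<lambda>q. Endo (lmult q :: 'a qop))"
  define t tc t0 v A B where defs: "t = Endo T" "tc = Endo (conj_op T)" "t0 = Endo (ext (comp0 T))"
    "v = Endo (vec_op T)" "A = Endo (Qc_inv s T)" "B = Endo (Qc_inv q T)"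
  have Q: "Endo (Qc q T) = i q * i q - i q * (t + tc) + t * tc" for q
    by (simp add: Qc_def i_def lscale_def lmult_mult Endo_hom power2_eq_square defs)
  have ext_i: "Endo (ext C) * i q = i q * Endo (ext C)" for C q
    by (simp only: i_def ext_lmult flip: Endo_hom(7))
  obtain N where N: "T o\<^sub>L conj_op T = ext N" "conj_op T o\<^sub>L T = ext N"
    by (rule BC_compose_conj_op[OF assms(1)])
  have sum: "t + tc = t0 + t0"
    unfolding defs using add_conj_op[OF TX] by (simp flip: Endo_hom(3))
  have tt: "t * tc = tc * t" and Ni: "t * tc * i r = i r * (t * tc)" for r
    unfolding defs by (simp_all only: N ext_i flip: Endo_hom(7))
  have t0i: "t0 * i r = i r * t0" for r by (simp add: defs ext_i)
  have t0t: "t0 * t = t * t0"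
    unfolding defs using BC_ext_commute[OF assms(1), of "comp0 T"] by (simp flip: Endo_hom(7))
  have tc: "tc = t0 + t0 - t" using sum by (simp add: eq_diff_eq add.commute)
  have t0tc: "t0 * tc = tc * t0" by (simp add: tc algebra_simps t0t)
  have v: "t0 - tc = v" by (simp add: defs conj_op_alt Endo_hom)
  have A: "A * Endo (Qc s T) = 1" "Endo (Qc s T) * A = 1"
    and B: "B * Endo (Qc q T) = 1" "Endo (Qc q T) * B = 1"
    using Qc_inverse[OF assms(1)] assms(2,3) by (simp_all add: defs flip: Endo_hom)
  \<comment> \<open>These are a quarter of \<open>P2R s T\<close> and \<open>P2L q T\<close>: the
    minus sign in front of the first summand of each operator turns the factor -4 of
    \<open>FR\<close> and \<open>FL\<close> into 4.\<close>
  define R L where "R = (i s - t0) * ((A * A) * (i s - tc))"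
    and "L = (i q - tc) * (B * B) * (i q - t0)"
  define M where "M = (A * (i s - tc)) * L + R * ((i q - tc) * B) - A * v * B"
  have key: "M * i q - i s * M = R - L"
    unfolding M_def R_def L_def
    by (rule second_order_resolvent_equation[OF v sum tt t0i t0i t0tc Ni Ni A[unfolded Q] B[unfolded Q]])
  have t0N: "t0 * (t * tc) = t * tc * t0"
    by (metis t0t t0tc mult.assoc)
  \<comment> \<open>\<open>P2L\<close> has the real component to the left of \<open>FL\<close>,
    whereas \<open>L\<close> carries \<open>t0\<close> on the far right; moving it there crosses
    \<open>B\<close>.\<close>
  have t0B: "t0 * B = B * t0"
    by (rule inverse_commute[OF B, symmetric])
      (simp add: Q sum t0N algebra_simps t0i t0i[THEN comm_assoc])
  have "Endo (P2R s T) = i s * (4 *\<^sub>R (A * A * (i s - tc))) - t0 * (4 *\<^sub>R (A * A * (i s - tc)))"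
    by (simp add: P2R_def FR_def lscale_def Endo_hom defs i_def)
  then have P2R: "Endo (P2R s T) = 4 *\<^sub>R R"
    by (simp add: R_def left_diff_distrib scaleR_diff_right)
  have "Endo (P2L q T) = 4 *\<^sub>R ((i q - tc) * (B * B)) * i q - t0 * (4 *\<^sub>R ((i q - tc) * (B * B)))"
    by (simp add: P2L_def FL_def lscale_def rscale_def Endo_hom defs i_def)
  also have "t0 * (4 *\<^sub>R ((i q - tc) * (B * B))) = 4 *\<^sub>R ((i q - tc) * (B * B)) * t0"
    by (simp add: algebra_simps t0i[THEN comm_assoc] t0tc[THEN comm_assoc] t0B t0B[THEN comm_assoc])
  finally have P2L: "Endo (P2L q T) = 4 *\<^sub>R L"
    by (simp add: L_def right_diff_distrib scaleR_diff_right)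
  have "Endo ((SR_inv s T o\<^sub>L P2L q T) + (P2R s T o\<^sub>L SL_inv q T)
      - 4 *\<^sub>R (Qc_inv s T o\<^sub>L vec_op T o\<^sub>L Qc_inv q T))
    = A * (i s - tc) * (4 *\<^sub>R L) + (4 *\<^sub>R R) * ((i q - tc) * B) - 4 *\<^sub>R (A * v * B)"
    by (simp add: Endo_hom P2R P2L SR_inv_def SL_inv_def lscale_def defs i_def)
  then have lhs: "Endo ((SR_inv s T o\<^sub>L P2L q T) + (P2R s T o\<^sub>L SL_inv q T)
      - 4 *\<^sub>R (Qc_inv s T o\<^sub>L vec_op T o\<^sub>L Qc_inv q T)) = 4 *\<^sub>R M"
    by (simp add: M_def scaleR_add_right scaleR_diff_right)
  have i: "i s + i (qcnj s) = (2 * qRe s) *\<^sub>R 1" "i (qcnj s) * i s = ((norm s)\<^sup>2) *\<^sub>R 1"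
    by (simp_all only: i_def qcnj_simps lmult_of_real Endo_hom(2,6)
        flip: Endo_hom(3,7) lmult_add lmult_mult)
  have iQ: "i (quatQ s q) = i q * i q - (2 * qRe s) *\<^sub>R i q + ((norm s)\<^sup>2) *\<^sub>R 1"
    by (simp only: i_def quatQ_def lmult_of_real lmult_add lmult_diff lmult_mult power2_eq_square[of q]
        Endo_hom scaleR_one mult_scaleR_left mult_1_left)
  \<comment> \<open>The map X to X q - s* X is applied to \<open>key\<close>. The coefficients
    \<open>i s + i (qcnj s)\<close> and \<open>i (qcnj s) * i s\<close> are real, so they pass
    through \<open>M\<close> and assemble \<open>quatQ s q\<close> on its right.\<close>
  have "(R - L) * i q - i (qcnj s) * (R - L)
    = M * (i q * i q) - (i s + i (qcnj s)) * M * i q + (i (qcnj s) * i s) * M"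
    by (simp add: algebra_simps flip: key)
  also have "\<dots> = M * i (quatQ s q)"
    by (simp only: i iQ) (simp add: algebra_simps)
  finally have D: "(R - L) * i q - i (qcnj s) * (R - L) = M * i (quatQ s q)" .
  have inv: "i (quatQ s q) * i (inverse (quatQ s q)) = 1"
    using quatQ_nonzero[OF assms(4)] lmult_of_real[of 1, where ?'a = 'a]
    by (simp add: i_def Endo_hom(2) flip: Endo_hom(7) lmult_mult)
  have "Endo (((P2R s T - P2L q T) \<lhd> q - qcnj s \<rhd> (P2R s T - P2L q T)) \<lhd> inverse (quatQ s q))
    = ((4 *\<^sub>R R - 4 *\<^sub>R L) * i q - i (qcnj s) * (4 *\<^sub>R R - 4 *\<^sub>R L)) * i (inverse (quatQ s q))"
    by (simp add: Endo_hom lscale_def rscale_def P2R P2L i_def)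
  also have "\<dots> = 4 *\<^sub>R ((R - L) * i q - i (qcnj s) * (R - L)) * i (inverse (quatQ s q))"
    by (simp flip: scaleR_diff_right)
  also have "\<dots> = 4 *\<^sub>R M"
    by (simp add: D mult.assoc inv)
  finally show ?thesis
    using lhs by (simp flip: Endo_eq_iff)
qed

end
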